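(* Haar-random circuits with Pauli noise anticoncentrate at least as fast as those without noise, in the following sense. Consider a family (indexed by the number of qubits $n$) of Haar-random circuit ensembles $\mathcal B$ with Pauli noise. If the corresponding noiseless circuits satisfy $$2^n\,\mathbb E_{\mathcal B}\,Z(U,\mathbb I)\le c$$ for some constant $c$ (independent of $n$), then the output probability distribution of the Haar-random circuits with Pauli noise is anticoncentrated, i.e. there exist constants $\alpha\in(0,1]$ and $c'>0$, independent of $n$, such that $\Pr_{\mathcal B}\left[p_{00\ldots0}\ge \alpha/2^n\right]\ge c'$, where $p_{00\ldots0}$ is the noisy output probability of the all-zeros string.
   Context: A depth-$d$ noisy circuit on $n$ qubits is the channel $\mathcal N_d=\mathcal E_d\circ\mathcal C_d\circ\cdots\circ\mathcal E_1\circ\mathcal C_1$, where $\mathcal C_m(\rho)=U_m\rho U_m^\dagger$ is a unitary layer and $\mathcal E_m$ is a noise channel. The circuit is Haar random if each $U_m$ is a tensor product of independent Haar-random two-qubit gates. The ensemble $\mathcal B$ is over a parallel architecture: $n$ is even and every qubit takes part in exactly one two-qubit gate in every layer ($d\ge1$); the pairing of qubits is fixed in advance but otherwise arbitrary and may change from layer to layer. $\mathbb E_{\mathcal B}$ and $\Pr_{\mathcal B}$ refer to the random unitary gates only; the noise channels are fixed. Pauli noise: $\mathcal E_m(\rho)=\sum_{E\in\mathcal P}p_m(E)\,E\rho E^\dagger$, with $\mathcal P$ the $n$-qubit Pauli group and $p_m$ a probability distribution on it. Throughout, noise is local: the noise channels act on at most $k=\Theta(1)$ qubits at a time. For a circuit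 with unitary layers $U=(U_1,\dots,U_d)$ and noise $\mathcal E=(\mathcal E_1,\dots,\mathcal E_d)$, the output probabilities are $p_x=\langle x|\mathcal N_d(|0\cdots0\rangle\langle0\cdots0|)|x\rangle$, $x\in\{0,1\}^n$, and the collision probability is $Z(U,\mathcal E)=\sum_{x\in\{0,1\}^n}p_x^2$. $Z(U,\mathbb I)$ is the collision probability of the same circuit without noise (all $\mathcal E_m$ equal to the identity channel). *)

theory Defs
  imports "HOL-Probability.Probability" "Jordan_Normal_Form.Schur_Decomposition"
begin

text \<open>
  Conventions. Operators on \<open>n\<close> qubits are \<open>2 ^ n\<close>-dimensional complex matrices. The index
  \<open>x < 2 ^ n\<close> stands for the computational basis state whose qubit \<open>i < n\<close> is \<open>bit x i\<close>; the
  all-zeros string is \<open>0\<close>. Two-qubit gates are matrices over \<open>bool \<times> bool\<close>, so that they carry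
  the topology and Borel structure of the library.
\<close>

subsection \<open>The unitary group on two qubits and its Haar measure\<close>

type_synonym gate = "complex ^ (bool \<times> bool) ^ (bool \<times> bool)"

definition gate_adjoint :: "gate \<Rightarrow> gate" where
  "gate_adjoint U =
     (\<chi> i j. cnj (Finite_Cartesian_Product.vec_nth (Finite_Cartesian_Product.vec_nth U j) i))"

definition unitary_gates :: "gate set" where
  "unitary_gates = {U. U ** gate_adjoint U = Finite_Cartesian_Product.mat 1 \<and>
                       gate_adjoint U ** U = Finite_Cartesian_Product.mat 1}"

text \<open>
  The Haar probability measure is unique, so every \<open>H\<close> with this property is the Haar measure.
\<close>

definition haar_measure :: "gate measure \<Rightarrow> bool" where
  "haar_measure H \<longleftrightarrow>
     prob_space H \<and> sets H = sets (restrict_space borel unitary_gates) \<and>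
     (\<forall>V\<in>unitary_gates. distr H H (\<lambda>U. V ** U) = H \<and> distr H H (\<lambda>U. U ** V) = H)"

subsection \<open>Random layers of two-qubit gates\<close>

text \<open>
  The orientation of a pair \<open>(a, b)\<close> only says which tensor factor of the gate acts on which qubit.
\<close>

definition qubit_pairing :: "nat \<Rightarrow> (nat \<times> nat) set \<Rightarrow> bool" where
  "qubit_pairing n P \<longleftrightarrow>
     P \<subseteq> {..<n} \<times> {..<n} \<and> (\<forall>(a, b)\<in>P. a \<noteq> b) \<and>
     (\<forall>i<n. \<exists>!e. e \<in> P \<and> (i = fst e \<or> i = snd e))"

text \<open>
  The tensor product of the gates \<open>G e\<close>, each placed on the pair of qubits \<open>e \<in> P\<close>: entries of a
  tensor product are products of entries of the factors.
\<close>

definition layer_unitary :: "nat \<Rightarrow> (nat \<times> nat) set \<Rightarrow> (nat \<times> nat \<Rightarrow> gate) \<Rightarrow> complex mat" where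
  "layer_unitary n P G = Matrix.mat (2 ^ n) (2 ^ n) (\<lambda>(x, y). \<Prod>e\<in>P.
     Finite_Cartesian_Product.vec_nth
       (Finite_Cartesian_Product.vec_nth (G e) (bit x (fst e), bit x (snd e)))
       (bit y (fst e), bit y (snd e)))"

text \<open>
  An architecture of depth \<open>d\<close> gives a pairing \<open>A m\<close> for every layer \<open>m \<in> {1..d}\<close>. An outcome of
  the ensemble assigns a gate to every \<open>(m, e)\<close> with \<open>e \<in> A m\<close>.
\<close>

definition circuit_ensemble ::
    "gate measure \<Rightarrow> nat \<Rightarrow> (nat \<Rightarrow> (nat \<times> nat) set) \<Rightarrow> (nat \<times> (nat \<times> nat) \<Rightarrow> gate) measure" where
  "circuit_ensemble H d A = PiM (SIGMA m:{1..d}. A m) (\<lambda>_. H)"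

definition circuit_layers ::
    "nat \<Rightarrow> (nat \<Rightarrow> (nat \<times> nat) set) \<Rightarrow> (nat \<times> (nat \<times> nat) \<Rightarrow> gate) \<Rightarrow> nat \<Rightarrow> complex mat" where
  "circuit_layers n A G m = layer_unitary n (A m) (\<lambda>e. G (m, e))"

subsection \<open>Pauli noise\<close>

datatype pauli = PI | PX | PY | PZ

fun pauli_entry :: "pauli \<Rightarrow> bool \<Rightarrow> bool \<Rightarrow> complex" where
  "pauli_entry PI x y = (if x = y then 1 else 0)"
| "pauli_entry PX x y = (if x \<noteq> y then 1 else 0)"
| "pauli_entry PY x y = (if x = y then 0 else if x then \<i> else - \<i>)"
| "pauli_entry PZ x y = (if x \<noteq> y then 0 else if x then - 1 else 1)"

definition pauli_string :: "nat \<Rightarrow> (nat \<Rightarrow> pauli) \<Rightarrow> complex mat" where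
  "pauli_string n s = Matrix.mat (2 ^ n) (2 ^ n)
     (\<lambda>(x, y). \<Prod>i<n. pauli_entry (s i) (bit x i) (bit y i))"

text \<open>The Pauli operators (with phases) acting as the identity outside the set of qubits \<open>S\<close>.\<close>

definition paulis_on :: "nat \<Rightarrow> nat set \<Rightarrow> complex mat set" where
  "paulis_on n S = {\<i> ^ a \<cdot>\<^sub>m pauli_string n s | a s. \<forall>i. i \<notin> S \<longrightarrow> s i = PI}"

definition pauli_group :: "nat \<Rightarrow> complex mat set" where
  "pauli_group n = paulis_on n {..<n}"

lemma finite_pauli_group: "finite (pauli_group n)"
proof -
  have UNIV_pauli: "UNIV = {PI, PX, PY, PZ}"
    using pauli.exhaust by auto
  have fin: "finite (UNIV :: pauli set)"
    unfolding UNIV_pauli by simp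
  have cut: "pauli_string n s = pauli_string n (restrict s {..<n})" for s
    unfolding pauli_string_def by (intro arg_cong[where f = "Matrix.mat _ _"] ext)
      (auto intro!: prod.cong)
  have period: "\<i> ^ a = \<i> ^ (a mod 4)" for a :: nat
  proof -
    have "\<i> ^ a = (\<i> ^ 4) ^ (a div 4) * \<i> ^ (a mod 4)"
      by (metis mult_div_mod_eq power_add power_mult)
    also have "\<i> ^ 4 = 1"
      by (simp add: power4_eq_xxxx)
    finally show ?thesis
      by simp
  qed
  have "pauli_group n \<subseteq>
      (\<lambda>(a, s). \<i> ^ a \<cdot>\<^sub>m pauli_string n s) ` ({..<4} \<times> ({..<n} \<rightarrow>\<^sub>E UNIV))"
  proof
    fix E assume "E \<in> pauli_group n"
    then obtain a s where E: "E = \<i> ^ a \<cdot>\<^sub>m pauli_string n s"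
      unfolding pauli_group_def paulis_on_def by blast
    have "E = \<i> ^ (a mod 4) \<cdot>\<^sub>m pauli_string n (restrict s {..<n})"
      using E period[of a] cut[of s] by metis
    then show "E \<in> (\<lambda>(a, s). \<i> ^ a \<cdot>\<^sub>m pauli_string n s) ` ({..<4} \<times> ({..<n} \<rightarrow>\<^sub>E UNIV))"
      by (intro image_eqI[where x = "(a mod 4, restrict s {..<n})"]) auto
  qed
  moreover have "finite ({..<4::nat} \<times> ({..<n} \<rightarrow>\<^sub>E (UNIV :: pauli set)))"
    by (intro finite_cartesian_product finite_PiE) (auto simp: fin)
  ultimately show ?thesis
    by (meson finite_imageI finite_subset)
qed

text \<open>The sum of matrices is written entrywise, since matrices form no type-class monoid.\<close>

definition pauli_channel :: "nat \<Rightarrow> complex mat pmf \<Rightarrow> complex mat \<Rightarrow> complex mat" where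
  "pauli_channel n p \<rho> = Matrix.mat (2 ^ n) (2 ^ n) (\<lambda>ij. \<Sum>E\<in>pauli_group n.
     complex_of_real (pmf p E) * (E * \<rho> * mat_adjoint E) $$ ij)"

text \<open>
  Locality: the channel is composed of finitely many Pauli channels, each of which acts on at most
  \<open>k\<close> qubits. Tensor products of channels on blocks of at most \<open>k\<close> qubits are a special case.
\<close>

definition local_pauli_channel :: "nat \<Rightarrow> nat \<Rightarrow> complex mat pmf \<Rightarrow> bool" where
  "local_pauli_channel n k p \<longleftrightarrow>
     (\<exists>qs. (\<forall>q\<in>set qs. \<exists>S\<subseteq>{..<n}. card S \<le> k \<and> set_pmf q \<subseteq> paulis_on n S) \<and>
           (\<forall>\<rho>\<in>carrier_mat (2 ^ n) (2 ^ n).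
              pauli_channel n p \<rho> = foldr (pauli_channel n) qs \<rho>))"

subsection \<open>Noisy circuits and their output distribution\<close>

definition unitary_channel :: "complex mat \<Rightarrow> complex mat \<Rightarrow> complex mat" where
  "unitary_channel U \<rho> = U * \<rho> * mat_adjoint U"

primrec noisy_circuit ::
    "(nat \<Rightarrow> complex mat) \<Rightarrow> (nat \<Rightarrow> complex mat \<Rightarrow> complex mat) \<Rightarrow> nat \<Rightarrow> complex mat \<Rightarrow> complex mat"
where
  "noisy_circuit U \<E> 0 = id"
| "noisy_circuit U \<E> (Suc m) = \<E> (Suc m) \<circ> unitary_channel (U (Suc m)) \<circ> noisy_circuit U \<E> m"

definition zero_state :: "nat \<Rightarrow> complex mat" where
  "zero_state n = Matrix.mat (2 ^ n) (2 ^ n) (\<lambda>(x, y). if x = 0 \<and> y = 0 then 1 else 0)"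

text \<open>
  \<open>Re\<close> merely converts the type: diagonal entries of density matrices are real.
\<close>

definition output_prob ::
    "nat \<Rightarrow> nat \<Rightarrow> (nat \<Rightarrow> complex mat) \<Rightarrow> (nat \<Rightarrow> complex mat \<Rightarrow> complex mat) \<Rightarrow> nat \<Rightarrow> real" where
  "output_prob n d U \<E> x = Re (noisy_circuit U \<E> d (zero_state n) $$ (x, x))"

definition collision_prob ::
    "nat \<Rightarrow> nat \<Rightarrow> (nat \<Rightarrow> complex mat) \<Rightarrow> (nat \<Rightarrow> complex mat \<Rightarrow> complex mat) \<Rightarrow> real" where
  "collision_prob n d U \<E> = (\<Sum>x<2 ^ n. (output_prob n d U \<E> x)\<^sup>2)"

end

theory Submission
  imports Defs
begin

text \<open>
  Pauli noise is a mixture of Pauli errors, so the noisy output probability is an average, over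
  trajectories of errors, of noiseless output probabilities of circuits whose layers are multiplied
  by Pauli strings. A Pauli string factors along the pairs of qubits of a layer and is absorbed into
  the gates by the left invariance of the Haar measure. Hence the noisy and the noiseless
  probability of the all-zeros string have the same mean and, by convexity of the square, the noisy
  second moment is at most the noiseless one. Bit flips absorbed into the last layer show that all
  outcomes have the same distribution, so the mean is \<open>1 / 2 ^ n\<close> and the noiseless second moment is
  the expected collision probability divided by \<open>2 ^ n\<close>. The Paley-Zygmund inequality concludes.
\<close>

subsection \<open>Tensor products over a pairing of the qubits\<close>

lemma sum_PiE_insert:
  assumes "x \<notin> S"
  shows "(\<Sum>g\<in>Pi\<^sub>E (insert x S) B. f g) = (\<Sum>y\<in>B x. \<Sum>g\<in>Pi\<^sub>E S B. f (g(x := y)))"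
proof -
  have "(\<Sum>g\<in>Pi\<^sub>E (insert x S) B. f g) = (\<Sum>(y, g)\<in>B x \<times> Pi\<^sub>E S B. f (g(x := y)))"
    unfolding PiE_insert_eq using inj_combinator[OF assms]
    by (subst sum.reindex) (auto simp: case_prod_unfold o_def)
  then show ?thesis
    by (simp add: sum.cartesian_product)
qed

text \<open>Distributivity: multiplying out a product of sums selects one summand per index. It
  factors sums over basis states in \<open>sum_pair_bits\<close> and later shows that the trajectory
  weights sum to 1.\<close>

lemma sum_PiE_prod:
  fixes f :: "'i \<Rightarrow> 'a \<Rightarrow> 'b::comm_semiring_1"
  assumes "finite S"
  shows "(\<Sum>g\<in>Pi\<^sub>E S B. \<Prod>i\<in>S. f i (g i)) = (\<Prod>i\<in>S. \<Sum>y\<in>B i. f i y)"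
  using assms
proof induction
  case (insert x S)
  have "(\<Sum>g\<in>Pi\<^sub>E (insert x S) B. \<Prod>i\<in>insert x S. f i (g i))
      = (\<Sum>y\<in>B x. \<Sum>g\<in>Pi\<^sub>E S B. f x y * (\<Prod>i\<in>S. f i (g i)))"
    using insert.hyps by (subst sum_PiE_insert) (auto simp: fun_upd_def intro!: sum.cong prod.cong arg_cong[where f = "(*) _"])
  then show ?case
    using insert by (simp add: sum_distrib_left[symmetric] sum_distrib_right[symmetric])
qed simp

lemma exists_nat_bits:
  obtains z :: nat where "z < 2 ^ n" and "\<And>i. i < n \<Longrightarrow> bit z i \<longleftrightarrow> b i"
proof
  let ?z = "horner_sum of_bool 2 (map b [0..<n]) :: nat"
  show "?z < 2 ^ n"
    using horner_sum_of_bool_2_less[of "map b [0..<n]"] by (simp add: horner_sum_of_bool_2_less)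
  show "bit ?z i \<longleftrightarrow> b i" if "i < n" for i
    using that by (simp add: bit_horner_sum_bit_iff)
qed

lemma nat_bits_eqI:
  fixes y z :: nat
  assumes "y < 2 ^ n" "z < 2 ^ n" "\<And>i. i < n \<Longrightarrow> bit y i \<longleftrightarrow> bit z i"
  shows "y = z"
  using assms by (metis bit_eq_iff bit_take_bit_iff take_bit_nat_eq_self_iff)

lemma qubit_pairing_finite: "qubit_pairing n P \<Longrightarrow> finite P"
  unfolding qubit_pairing_def by (meson finite_SigmaI finite_lessThan finite_subset)

lemma qubit_pairing_unique:
  assumes P: "qubit_pairing n P"
    and e: "e \<in> P" "e' \<in> P" "i \<in> {fst e, snd e}" "i \<in> {fst e', snd e'}"
  shows "e = e'"
proof -
  have "i < n" using P e unfolding qubit_pairing_def by auto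
  then show ?thesis using P e unfolding qubit_pairing_def by blast
qed

text \<open>The pairs partition the qubits, so a product over qubits can be regrouped by gates. This
  links Pauli strings, indexed by qubits, with layers, indexed by pairs.\<close>

lemma prod_qubit_pairing:
  fixes f :: "nat \<Rightarrow> 'b::comm_monoid_mult"
  assumes P: "qubit_pairing n P"
  shows "(\<Prod>i<n. f i) = (\<Prod>e\<in>P. f (fst e) * f (snd e))"
proof -
  have ne: "fst e \<noteq> snd e" if "e \<in> P" for e
    using P that unfolding qubit_pairing_def by auto
  have "{..<n} = (\<Union>e\<in>P. {fst e, snd e})"
  proof (intro equalityI subsetI)
    fix i assume "i \<in> {..<n}"
    then show "i \<in> (\<Union>e\<in>P. {fst e, snd e})"
      using P unfolding qubit_pairing_def by blast
  next
    fix i assume "i \<in> (\<Union>e\<in>P. {fst e, snd e})"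
    then show "i \<in> {..<n}"
      using P unfolding qubit_pairing_def by auto
  qed
  then have "(\<Prod>i<n. f i) = (\<Prod>i\<in>(\<Union>e\<in>P. {fst e, snd e}). f i)"
    by simp
  also have "\<dots> = (\<Prod>e\<in>P. \<Prod>i\<in>{fst e, snd e}. f i)"
  proof (intro prod.UNION_disjoint ballI impI)
    show "{fst e, snd e} \<inter> {fst e', snd e'} = {}" if "e \<in> P" "e' \<in> P" "e \<noteq> e'" for e e'
      using qubit_pairing_unique[OF P] that by blast
  qed (simp_all add: qubit_pairing_finite[OF P])
  also have "\<dots> = (\<Prod>e\<in>P. f (fst e) * f (snd e))"
    using ne by (intro prod.cong) auto
  finally show ?thesis .
qed

text \<open>A basis state amounts to a free choice of two bits for each pair: since every qubit lies
  in exactly one pair, these choices determine all bits and never conflict.\<close>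

lemma bij_betw_pair_bits:
  assumes P: "qubit_pairing n P"
  shows "bij_betw (\<lambda>z::nat. \<lambda>e\<in>P. (bit z (fst e), bit z (snd e))) {..<2 ^ n} (P \<rightarrow>\<^sub>E UNIV)"
    (is "bij_betw ?\<phi> _ _")
  unfolding bij_betw_def
proof
  have cover: "\<exists>e\<in>P. i = fst e \<or> i = snd e" if "i < n" for i
    using P that unfolding qubit_pairing_def by blast
  note uniq = qubit_pairing_unique[OF P]
  show "inj_on ?\<phi> {..<2 ^ n}"
  proof (rule inj_onI, rule nat_bits_eqI)
    fix y z i assume yz: "?\<phi> y = ?\<phi> z" and "i < n"
    then obtain e where e: "e \<in> P" "i = fst e \<or> i = snd e" using cover by blast
    then show "bit y i \<longleftrightarrow> bit z i"
      using fun_cong[OF yz, of e] by auto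
  qed auto
  show "?\<phi> ` {..<2 ^ n} = P \<rightarrow>\<^sub>E UNIV"
  proof (intro equalityI subsetI)
    fix g :: "nat \<times> nat \<Rightarrow> bool \<times> bool" assume g: "g \<in> P \<rightarrow>\<^sub>E UNIV"
    \<comment> \<open>The bit of \<open>z\<close> at qubit \<open>i\<close> is read off from the
      pair containing \<open>i\<close>; the existential says so without naming that pair.\<close>
    obtain z :: nat where z: "z < 2 ^ n"
      "\<And>i. i < n \<Longrightarrow> bit z i \<longleftrightarrow> (\<exists>e\<in>P. (i = fst e \<and> fst (g e)) \<or> (i = snd e \<and> snd (g e)))"
      using exists_nat_bits[of n "\<lambda>i. \<exists>e\<in>P. (i = fst e \<and> fst (g e)) \<or> (i = snd e \<and> snd (g e))"]
      by blast
    have "?\<phi> z e = g e" for e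
    proof (cases "e \<in> P")
      case True
      then have "fst e < n" "snd e < n" "fst e \<noteq> snd e"
        using P unfolding qubit_pairing_def by auto
      \<comment> \<open>A pair sharing a qubit with \<open>e\<close> is \<open>e\<close> itself, so
        the existential collapses to \<open>g e\<close>; \<open>fst e \<noteq> snd e\<close> keeps
        the two components apart.\<close>
      moreover have "f = e" if "f \<in> P" "fst f \<in> {fst e, snd e} \<or> snd f \<in> {fst e, snd e}" for f
        using uniq[of f e] that True by blast
      ultimately have "bit z (fst e) = fst (g e)" "bit z (snd e) = snd (g e)"
        unfolding z(2)[OF \<open>fst e < n\<close>] z(2)[OF \<open>snd e < n\<close>] using True by (metis insertCI)+
      then show ?thesis using True by simp
    qed (use g in auto)
    then have "?\<phi> z = g" by blast
    with z(1) show "g \<in> ?\<phi> ` {..<2 ^ n}" by blast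
  qed auto
qed

text \<open>Reindexing along \<open>bij_betw_pair_bits\<close> turns the sum over intermediate
  states in a matrix product into one independent sum for each gate.\<close>

lemma sum_pair_bits:
  fixes f :: "nat \<times> nat \<Rightarrow> bool \<times> bool \<Rightarrow> 'b::comm_semiring_1"
  assumes P: "qubit_pairing n P"
  shows "(\<Sum>z<2 ^ n::nat. \<Prod>e\<in>P. f e (bit z (fst e), bit z (snd e))) = (\<Prod>e\<in>P. \<Sum>b\<in>UNIV. f e b)"
proof -
  have "(\<Sum>z<2 ^ n::nat. \<Prod>e\<in>P. f e (bit z (fst e), bit z (snd e)))
      = (\<Sum>z<2 ^ n::nat. (\<lambda>g. \<Prod>e\<in>P. f e (g e)) (\<lambda>e\<in>P. (bit z (fst e), bit z (snd e))))"
    by (intro sum.cong prod.cong) auto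
  also have "\<dots> = (\<Sum>g\<in>P \<rightarrow>\<^sub>E UNIV. \<Prod>e\<in>P. f e (g e))"
    by (rule sum.reindex_bij_betw[OF bij_betw_pair_bits[OF P]])
  finally show ?thesis
    by (simp add: sum_PiE_prod[OF qubit_pairing_finite[OF P]])
qed

section \<open>Layers as tensor products of gates\<close>

abbreviation gate_entry :: "gate \<Rightarrow> bool \<times> bool \<Rightarrow> bool \<times> bool \<Rightarrow> complex" where
  "gate_entry U i j \<equiv> Finite_Cartesian_Product.vec_nth (Finite_Cartesian_Product.vec_nth U i) j"

lemma layer_unitary_carrier [simp]: "layer_unitary n P G \<in> carrier_mat (2 ^ n) (2 ^ n)"
  unfolding layer_unitary_def by simp

lemma pauli_string_carrier [simp]: "pauli_string n s \<in> carrier_mat (2 ^ n) (2 ^ n)"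
  unfolding pauli_string_def by simp

lemma layer_unitary_entry:
  assumes "x < 2 ^ n" "y < 2 ^ n"
  shows "layer_unitary n P G $$ (x, y) = (\<Prod>e\<in>P.
    gate_entry (G e) (bit x (fst e), bit x (snd e)) (bit y (fst e), bit y (snd e)))"
  using assms unfolding layer_unitary_def by simp

lemma mat_mult_entry:
  fixes A B :: "complex mat"
  assumes "A \<in> carrier_mat N N" "B \<in> carrier_mat N N" "i < N" "j < N"
  shows "(A * B) $$ (i, j) = (\<Sum>k<N. A $$ (i, k) * B $$ (k, j))"
  using assms by (auto simp: scalar_prod_def atLeast0LessThan intro!: sum.cong)

text \<open>Mixed-product rule for tensor products: the sum over intermediate basis states factors
  over the pairs, leaving one 4-by-4 matrix product for each gate.\<close>

lemma layer_unitary_mult: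
  assumes P: "qubit_pairing n P"
  shows "layer_unitary n P G * layer_unitary n P G' = layer_unitary n P (\<lambda>e. G e ** G' e)"
proof (rule eq_matI)
  fix x y assume "x < dim_row (layer_unitary n P (\<lambda>e. G e ** G' e))"
    "y < dim_col (layer_unitary n P (\<lambda>e. G e ** G' e))"
  then have xy: "x < 2 ^ n" "y < 2 ^ n" by (simp_all add: layer_unitary_def)
  then have "(layer_unitary n P G * layer_unitary n P G') $$ (x, y) = (\<Sum>z<2 ^ n::nat. \<Prod>e\<in>P.
      gate_entry (G e) (bit x (fst e), bit x (snd e)) (bit z (fst e), bit z (snd e)) *
      gate_entry (G' e) (bit z (fst e), bit z (snd e)) (bit y (fst e), bit y (snd e)))"
    by (subst mat_mult_entry[of _ "2 ^ n"]) (auto simp: layer_unitary_entry prod.distrib)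
  also have "\<dots> = layer_unitary n P (\<lambda>e. G e ** G' e) $$ (x, y)"
    using xy by (subst sum_pair_bits[OF P]) (simp add: layer_unitary_entry matrix_matrix_mult_def)
  finally show "(layer_unitary n P G * layer_unitary n P G') $$ (x, y)
    = layer_unitary n P (\<lambda>e. G e ** G' e) $$ (x, y)" .
qed (simp_all add: layer_unitary_def)

text \<open>A product over qubits of Kronecker deltas of bits is the Kronecker delta of the indices,
  because \<open>n\<close> bits determine a number below \<open>2 ^ n\<close>.\<close>

lemma layer_unitary_one:
  assumes P: "qubit_pairing n P" and xy: "x < 2 ^ n" "y < 2 ^ n"
  shows "layer_unitary n P (\<lambda>_. Finite_Cartesian_Product.mat 1) $$ (x, y) = (if x = y then 1 else 0)"
proof -
  have "layer_unitary n P (\<lambda>_. Finite_Cartesian_Product.mat 1) $$ (x, y)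
      = (\<Prod>e\<in>P. (\<lambda>i. if bit x i = bit y i then 1 else 0) (fst e)
          * (\<lambda>i. if bit x i = bit y i then 1 else 0) (snd e))"
    unfolding layer_unitary_entry[OF xy]
    by (intro prod.cong) (auto simp: Finite_Cartesian_Product.mat_def)
  also have "\<dots> = (\<Prod>i<n. if bit x i = bit y i then 1 else 0)"
    using prod_qubit_pairing[OF P, of "\<lambda>i. if bit x i = bit y i then 1 else 0 :: complex"] by simp
  also have "\<dots> = (if x = y then 1 else 0)"
    using nat_bits_eqI[OF xy] by (auto simp: prod_zero_iff)
  finally show ?thesis .
qed

text \<open>The adjoint of a tensor product is the tensor product of the adjoints, so orthonormality
  of the columns reduces to unitarity of each gate. In this entrywise form it enters the norm
  computation in \<open>noiseless_pure\<close>.\<close>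

lemma layer_unitary_isometry:
  assumes P: "qubit_pairing n P" and G: "\<And>e. e \<in> P \<Longrightarrow> G e \<in> unitary_gates"
    and yz: "y < 2 ^ n" "z < 2 ^ n"
  shows "(\<Sum>x<2 ^ n. cnj (layer_unitary n P G $$ (x, y)) * layer_unitary n P G $$ (x, z))
    = (if y = z then 1 else 0)"
proof -
  have "(\<Sum>x<2 ^ n. cnj (layer_unitary n P G $$ (x, y)) * layer_unitary n P G $$ (x, z))
      = (layer_unitary n P (\<lambda>e. gate_adjoint (G e)) * layer_unitary n P G) $$ (y, z)"
    using yz by (subst mat_mult_entry[of _ "2 ^ n"])
      (auto simp: layer_unitary_entry gate_adjoint_def cnj_prod)
  also have "\<dots> = layer_unitary n P (\<lambda>_. Finite_Cartesian_Product.mat 1) $$ (y, z)"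
    using G yz unfolding layer_unitary_mult[OF P]
    by (auto simp: layer_unitary_entry unitary_gates_def intro!: prod.cong)
  finally show ?thesis
    using layer_unitary_one[OF P yz] by simp
qed

section \<open>Pauli strings as layers of unitary gates\<close>

definition pauli_gate :: "pauli \<Rightarrow> pauli \<Rightarrow> gate" where
  "pauli_gate a b = (\<chi> i j. pauli_entry a (fst i) (fst j) * pauli_entry b (snd i) (snd j))"

text \<open>A Pauli string is a product over single qubits, so it splits along any pairing. This is
  what lets errors merge with the layer before them.\<close>

lemma pauli_string_eq_layer_unitary:
  assumes P: "qubit_pairing n P"
  shows "pauli_string n s = layer_unitary n P (\<lambda>e. pauli_gate (s (fst e)) (s (snd e)))"
  using prod_qubit_pairing[OF P, of "\<lambda>i. pauli_entry (s i) (bit _ i) (bit _ i)"]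
  by (intro eq_matI) (auto simp: pauli_string_def layer_unitary_def pauli_gate_def)

lemma gate_eqI: "(\<And>i j. gate_entry U i j = gate_entry V i j) \<Longrightarrow> U = V"
  by (simp add: Finite_Cartesian_Product.vec_eq_iff)

lemma pauli_entry_orthonormal:
  "(\<Sum>b\<in>UNIV. pauli_entry s x b * cnj (pauli_entry s y b)) = (if x = y then 1 else 0)"
  "(\<Sum>b\<in>UNIV. pauli_entry s b y * cnj (pauli_entry s b x)) = (if x = y then 1 else 0)"
  by (cases s; cases x; cases y; simp add: UNIV_bool)+

lemma pauli_gate_unitary: "pauli_gate a b \<in> unitary_gates"
proof -
  \<comment> \<open>A sum over pairs of bits factors, which reduces unitarity of the tensor product
    to \<open>pauli_entry_orthonormal\<close> in each factor.\<close>
  have *: "(\<Sum>k\<in>UNIV. f (fst k) * g (snd k)) = (\<Sum>u\<in>UNIV. f u) * (\<Sum>v\<in>UNIV. g v)"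
    for f g :: "bool \<Rightarrow> complex"
    by (simp add: UNIV_Times_UNIV[symmetric] sum_product sum.cartesian_product case_prod_unfold
        del: UNIV_Times_UNIV)
  have "pauli_gate a b ** gate_adjoint (pauli_gate a b) = Finite_Cartesian_Product.mat 1"
  proof (rule gate_eqI)
    fix i j
    show "gate_entry (pauli_gate a b ** gate_adjoint (pauli_gate a b)) i j
        = gate_entry (Finite_Cartesian_Product.mat 1) i j"
      using *[of "\<lambda>u. pauli_entry a (fst i) u * cnj (pauli_entry a (fst j) u)"
          "\<lambda>v. pauli_entry b (snd i) v * cnj (pauli_entry b (snd j) v)"]
      by (simp add: matrix_matrix_mult_def pauli_gate_def gate_adjoint_def
          Finite_Cartesian_Product.mat_def pauli_entry_orthonormal mult_ac prod_eq_iff)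
  qed
  moreover have "gate_adjoint (pauli_gate a b) ** pauli_gate a b = Finite_Cartesian_Product.mat 1"
  proof (rule gate_eqI)
    fix i j
    show "gate_entry (gate_adjoint (pauli_gate a b) ** pauli_gate a b) i j
        = gate_entry (Finite_Cartesian_Product.mat 1) i j"
      using *[of "\<lambda>u. pauli_entry a u (fst j) * cnj (pauli_entry a u (fst i))"
          "\<lambda>v. pauli_entry b v (snd j) * cnj (pauli_entry b v (snd i))"]
      by (simp add: matrix_matrix_mult_def pauli_gate_def gate_adjoint_def
          Finite_Cartesian_Product.mat_def pauli_entry_orthonormal mult_ac prod_eq_iff)
  qed
  ultimately show ?thesis
    unfolding unitary_gates_def by simp
qed

subsection \<open>Circuits as mixtures of Pauli trajectories\<close>

lemma mat_adjoint_entry: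
  fixes A :: "complex mat"
  assumes "A \<in> carrier_mat N N" "i < N" "j < N"
  shows "mat_adjoint A $$ (i, j) = cnj (A $$ (j, i))"
  using assms by (simp add: mat_adjoint_def mat_of_rows_def)

lemma mat_adjoint_carrier [simp]:
  "A \<in> carrier_mat N N \<Longrightarrow> mat_adjoint A \<in> carrier_mat N N"
  by (rule carrier_matI) (simp_all add: mat_adjoint_def)

lemma mat_adjoint_mult:
  fixes A B :: "complex mat"
  assumes A: "A \<in> carrier_mat N N" and B: "B \<in> carrier_mat N N"
  shows "mat_adjoint (A * B) = mat_adjoint B * mat_adjoint A"
proof (rule eq_matI)
  fix i j assume "i < dim_row (mat_adjoint B * mat_adjoint A)"
    "j < dim_col (mat_adjoint B * mat_adjoint A)"
  then have ij: "i < N" "j < N"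
    using A B by (auto simp: mat_adjoint_def)
  then have "mat_adjoint (A * B) $$ (i, j) = cnj (\<Sum>k<N. A $$ (j, k) * B $$ (k, i))"
    using A B by (simp add: mat_adjoint_entry[of _ N] mat_mult_entry[of _ N] del: index_mult_mat)
  also have "\<dots> = (mat_adjoint B * mat_adjoint A) $$ (i, j)"
    using ij A B by (simp add: mat_adjoint_entry[of _ N] mat_mult_entry[of _ N] mult.commute del: index_mult_mat)
  finally show "mat_adjoint (A * B) $$ (i, j) = (mat_adjoint B * mat_adjoint A) $$ (i, j)" .
qed (simp_all add: mat_adjoint_def)

lemma unitary_channel_carrier [simp]:
  "U \<in> carrier_mat N N \<Longrightarrow> \<rho> \<in> carrier_mat N N \<Longrightarrow> unitary_channel U \<rho> \<in> carrier_mat N N"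
  unfolding unitary_channel_def by (intro mult_carrier_mat[of _ N N _ N] mat_adjoint_carrier)

lemma unitary_channel_mult:
  assumes "A \<in> carrier_mat N N" "B \<in> carrier_mat N N" "\<rho> \<in> carrier_mat N N"
  shows "unitary_channel A (unitary_channel B \<rho>) = unitary_channel (A * B) \<rho>"
proof -
  have "A * (B * \<rho> * mat_adjoint B) * mat_adjoint A = A * (B * \<rho>) * mat_adjoint B * mat_adjoint A"
    using assms by (subst assoc_mult_mat[of A N N _ N _ N]) auto
  also have "\<dots> = A * (B * \<rho>) * (mat_adjoint B * mat_adjoint A)"
    using assms by (subst assoc_mult_mat[of _ N N _ N _ N]) auto
  also have "A * (B * \<rho>) = A * B * \<rho>"
    using assms by (subst assoc_mult_mat[of _ N N _ N _ N]) auto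
  finally show ?thesis
    unfolding unitary_channel_def mat_adjoint_mult[OF assms(1,2)] .
qed

lemma unitary_channel_entry:
  assumes "U \<in> carrier_mat N N" "\<rho> \<in> carrier_mat N N" "x < N" "y < N"
  shows "unitary_channel U \<rho> $$ (x, y)
    = (\<Sum>j<N. \<Sum>i<N. U $$ (x, i) * \<rho> $$ (i, j) * cnj (U $$ (y, j)))"
  using assms unfolding unitary_channel_def
  by (simp add: mat_adjoint_entry[of _ N] mat_mult_entry[of _ N] sum_distrib_right del: index_mult_mat)

text \<open>The scalar meets its own conjugate on the other side of the state. Hence the phases
  \<open>\<i> ^ a\<close> in the Pauli group leave no trace in a channel.\<close>

lemma unitary_channel_phase:
  assumes "U \<in> carrier_mat N N" "\<rho> \<in> carrier_mat N N" and c: "c * cnj c = 1"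
  shows "unitary_channel (c \<cdot>\<^sub>m U) \<rho> = unitary_channel U \<rho>"
proof (rule eq_matI)
  have *: "c * u * r * (cnj c * v) = u * r * v" for u r v
  proof -
    have "c * u * r * (cnj c * v) = (c * cnj c) * (u * r * v)" by (simp only: mult_ac)
    then show ?thesis using c by simp
  qed
  fix x y assume "x < dim_row (unitary_channel U \<rho>)" "y < dim_col (unitary_channel U \<rho>)"
  then have "x < N" "y < N"
    using unitary_channel_carrier[OF assms(1,2)] by auto
  then show "unitary_channel (c \<cdot>\<^sub>m U) \<rho> $$ (x, y) = unitary_channel U \<rho> $$ (x, y)"
    using assms(1,2) by (simp add: unitary_channel_entry[of _ N] *)
qed (simp_all add: unitary_channel_def mat_adjoint_def)

lemma pauli_channel_carrier [simp]: "pauli_channel n p \<rho> \<in> carrier_mat (2 ^ n) (2 ^ n)"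
  by (simp add: pauli_channel_def)

lemma pauli_group_carrier: "E \<in> pauli_group n \<Longrightarrow> E \<in> carrier_mat (2 ^ n) (2 ^ n)"
  by (auto simp: pauli_group_def paulis_on_def)

lemma zero_state_carrier [simp]: "zero_state n \<in> carrier_mat (2 ^ n) (2 ^ n)"
  by (simp add: zero_state_def)

lemma noisy_circuit_carrier:
  assumes "\<And>m. m \<in> {1..d} \<Longrightarrow> U m \<in> carrier_mat N N" "\<rho> \<in> carrier_mat N N"
    "\<And>m \<sigma>. m \<in> {1..d} \<Longrightarrow> \<sigma> \<in> carrier_mat N N \<Longrightarrow> \<E> m \<sigma> \<in> carrier_mat N N"
  shows "noisy_circuit U \<E> d \<rho> \<in> carrier_mat N N"
  using assms(1,3)
proof (induction d)
  case (Suc d)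
  have "noisy_circuit U \<E> d \<rho> \<in> carrier_mat N N"
    by (rule Suc.IH; rule Suc.prems) simp_all
  then show ?case
    using Suc.prems by simp
qed (simp add: assms(2))

text \<open>Conjugation is linear in the state, so expanding the mixtures layer by layer gives a sum
  over trajectories \<open>E\<close> with one error for each layer. The weights are products because
  the layers draw their errors independently.\<close>

lemma noisy_circuit_pauli_trajectories:
  assumes U: "\<And>m. m \<in> {1..d} \<Longrightarrow> U m \<in> carrier_mat (2 ^ n) (2 ^ n)"
    and \<rho>: "\<rho> \<in> carrier_mat (2 ^ n) (2 ^ n)"
    and xy: "x < 2 ^ n" "y < 2 ^ n"
  shows "noisy_circuit U (\<lambda>m. pauli_channel n (p m)) d \<rho> $$ (x, y)
    = (\<Sum>E\<in>{1..d} \<rightarrow>\<^sub>E pauli_group n. complex_of_real (\<Prod>m\<in>{1..d}. pmf (p m) (E m)) *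
        noisy_circuit (\<lambda>m. E m * U m) (\<lambda>_. id) d \<rho> $$ (x, y))"
  using U xy
proof (induction d arbitrary: x y)
  case (Suc d)
  let ?G = "pauli_group n" and ?N = "2 ^ n :: nat"
  let ?T = "{1..d} \<rightarrow>\<^sub>E ?G"
  let ?\<sigma> = "noisy_circuit U (\<lambda>m. pauli_channel n (p m)) d \<rho>"
  let ?w = "\<lambda>E. complex_of_real (\<Prod>m\<in>{1..d}. pmf (p m) (E m))"
  let ?\<tau> = "\<lambda>E. noisy_circuit (\<lambda>m. E m * U m) (\<lambda>_. id) d \<rho>"
  have U: "U m \<in> carrier_mat ?N ?N" if "m \<in> {1..Suc d}" for m
    using Suc.prems that by blast
  have \<sigma>: "?\<sigma> \<in> carrier_mat ?N ?N"
    using U \<rho> by (intro noisy_circuit_carrier) auto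
  have \<tau>: "?\<tau> E \<in> carrier_mat ?N ?N" if "E \<in> ?T" for E
  proof (rule noisy_circuit_carrier)
    show "E m * U m \<in> carrier_mat ?N ?N" if "m \<in> {1..d}" for m
      using U[of m] pauli_group_carrier[of "E m"] \<open>E \<in> ?T\<close> that by (auto simp: PiE_iff intro!: mult_carrier_mat)
  qed (simp_all add: \<rho>)
  have ins: "{1..Suc d} = insert (Suc d) {1..d}" and notin: "Suc d \<notin> {1..d}"
    by auto
  have IH: "?\<sigma> $$ (i, j) = (\<Sum>E\<in>?T. ?w E * ?\<tau> E $$ (i, j))" if "i < ?N" "j < ?N" for i j
    using U that by (intro Suc.IH) auto
  \<comment> \<open>The first \<open>d\<close> layers do not see the error chosen for layer
    \<open>Suc d\<close>.\<close>
  have upd: "noisy_circuit (\<lambda>m. (E(Suc d := F)) m * U m) (\<lambda>_. id) d \<rho> = ?\<tau> E" for E F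
  proof -
    have "noisy_circuit (\<lambda>m. (E(Suc d := F)) m * U m) (\<lambda>_. id) k \<rho>
        = noisy_circuit (\<lambda>m. E m * U m) (\<lambda>_. id) k \<rho>" if "k \<le> d" for k
      using that by (induction k) auto
    then show ?thesis by blast
  qed
  \<comment> \<open>Linearity: the sum over trajectories is pulled out of the conjugation by
    exchanging finite sums.\<close>
  have step: "unitary_channel (F * U (Suc d)) ?\<sigma> $$ (x, y)
      = (\<Sum>E\<in>?T. ?w E * unitary_channel (F * U (Suc d)) (?\<tau> E) $$ (x, y))" if F: "F \<in> ?G" for F
  proof -
    have FU: "F * U (Suc d) \<in> carrier_mat ?N ?N"
      using pauli_group_carrier[OF F] U[of "Suc d"] by auto
    let ?V = "\<lambda>i j. (F * U (Suc d)) $$ (i, j)"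
    have "unitary_channel (F * U (Suc d)) ?\<sigma> $$ (x, y)
        = (\<Sum>j<?N. \<Sum>i<?N. \<Sum>E\<in>?T. ?w E * (?V x i * ?\<tau> E $$ (i, j) * cnj (?V y j)))"
      unfolding unitary_channel_entry[OF FU \<sigma> Suc.prems(2,3)]
      by (intro sum.cong refl) (simp add: IH sum_distrib_left sum_distrib_right mult_ac del: of_real_prod)
    also have "\<dots> = (\<Sum>j<?N. \<Sum>E\<in>?T. \<Sum>i<?N. ?w E * (?V x i * ?\<tau> E $$ (i, j) * cnj (?V y j)))"
      by (intro sum.cong refl) (rule sum.swap)
    also have "\<dots> = (\<Sum>E\<in>?T. \<Sum>j<?N. \<Sum>i<?N. ?w E * (?V x i * ?\<tau> E $$ (i, j) * cnj (?V y j)))"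
      by (rule sum.swap)
    also have "\<dots> = (\<Sum>E\<in>?T. ?w E * unitary_channel (F * U (Suc d)) (?\<tau> E) $$ (x, y))"
      by (intro sum.cong refl)
        (simp add: unitary_channel_entry[OF FU \<tau> Suc.prems(2,3)] sum_distrib_left)
    finally show ?thesis .
  qed
  have "noisy_circuit U (\<lambda>m. pauli_channel n (p m)) (Suc d) \<rho> $$ (x, y)
      = (\<Sum>F\<in>?G. complex_of_real (pmf (p (Suc d)) F)
          * unitary_channel F (unitary_channel (U (Suc d)) ?\<sigma>) $$ (x, y))"
    using Suc.prems by (simp add: pauli_channel_def unitary_channel_def)
  also have "\<dots> = (\<Sum>F\<in>?G. complex_of_real (pmf (p (Suc d)) F)
          * (\<Sum>E\<in>?T. ?w E * unitary_channel (F * U (Suc d)) (?\<tau> E) $$ (x, y)))"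
    by (intro sum.cong refl)
      (simp add: unitary_channel_mult[OF pauli_group_carrier U \<sigma>] step)
  also have "\<dots> = (\<Sum>F\<in>?G. \<Sum>E\<in>?T. complex_of_real (pmf (p (Suc d)) F) * ?w E
      * noisy_circuit (\<lambda>m. (E(Suc d := F)) m * U m) (\<lambda>_. id) (Suc d) \<rho> $$ (x, y))"
    unfolding noisy_circuit.simps o_def upd by (simp add: sum_distrib_left mult_ac)
  also have "\<dots> = (\<Sum>F\<in>?G. \<Sum>E\<in>?T.
      complex_of_real (\<Prod>m\<in>{1..Suc d}. pmf (p m) ((E(Suc d := F)) m))
      * noisy_circuit (\<lambda>m. (E(Suc d := F)) m * U m) (\<lambda>_. id) (Suc d) \<rho> $$ (x, y))"
    by (intro sum.cong refl arg_cong2[where f = "(*)"])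
      (simp add: atLeastAtMostSuc_conv)
  also have "\<dots> = (\<Sum>E\<in>{1..Suc d} \<rightarrow>\<^sub>E ?G.
      complex_of_real (\<Prod>m\<in>{1..Suc d}. pmf (p m) (E m))
      * noisy_circuit (\<lambda>m. E m * U m) (\<lambda>_. id) (Suc d) \<rho> $$ (x, y))"
    by (simp only: ins sum_PiE_insert[OF notin])
  finally show ?case .
next
  case 0
  \<comment> \<open>At depth 0 the only trajectory is the empty one, whose weight is the empty
    product 1.\<close>
  show ?case by (simp add: PiE_empty_domain)
qed

section \<open>Noiseless circuits: pure states and bit flips\<close>

lemma noiseless_circuit_Suc: "noisy_circuit U (\<lambda>_. id) (Suc d) \<rho>
    = unitary_channel (U (Suc d)) (noisy_circuit U (\<lambda>_. id) d \<rho>)"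
  by (simp only: noisy_circuit.simps o_apply id_apply)

text \<open>Without noise the state stays a projector |v><v| on a unit vector: each layer replaces
  \<open>v\<close> by its image, and orthonormal columns preserve the norm. Outcome probabilities
  are therefore squared moduli that sum to 1.\<close>

lemma noiseless_pure:
  assumes U: "\<And>m. m \<in> {1..d} \<Longrightarrow> U m \<in> carrier_mat (2 ^ n) (2 ^ n)"
    and iso: "\<And>m y z. m \<in> {1..d} \<Longrightarrow> y < 2 ^ n \<Longrightarrow> z < 2 ^ n \<Longrightarrow>
      (\<Sum>x<2 ^ n. cnj (U m $$ (x, y)) * U m $$ (x, z)) = (if y = z then 1 else 0)"
  shows "\<exists>v :: nat \<Rightarrow> complex. (\<forall>x<2 ^ n. \<forall>y<2 ^ n.
      noisy_circuit U (\<lambda>_. id) d (zero_state n) $$ (x, y) = v x * cnj (v y)) \<and>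
      (\<Sum>x<2 ^ n. cnj (v x) * v x) = 1"
  using U iso
proof (induction d)
  case 0
  let ?v = "\<lambda>x::nat. if x = 0 then 1 else 0 :: complex"
  have "(\<Sum>x<2 ^ n::nat. cnj (?v x) * ?v x) = (\<Sum>x<2 ^ n::nat. if x = 0 then 1 else 0)"
    by (intro sum.cong) auto
  also have "\<dots> = 1"
    by simp
  finally show ?case
    by (intro exI[of _ ?v]) (simp add: zero_state_def)
next
  case (Suc d)
  let ?N = "2 ^ n :: nat" and ?U = "U (Suc d)" and ?\<rho> = "noisy_circuit U (\<lambda>_. id) d (zero_state n)"
  have "\<exists>v :: nat \<Rightarrow> complex. (\<forall>x<?N. \<forall>y<?N. ?\<rho> $$ (x, y) = v x * cnj (v y)) \<and>
      (\<Sum>x<?N. cnj (v x) * v x) = 1"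
    by (rule Suc.IH; rule Suc.prems) simp_all
  then obtain v where v: "\<And>x y. x < ?N \<Longrightarrow> y < ?N \<Longrightarrow> ?\<rho> $$ (x, y) = v x * cnj (v y)"
    and norm: "(\<Sum>x<?N. cnj (v x) * v x) = 1"
    by blast
  have U: "?U \<in> carrier_mat ?N ?N"
    using Suc.prems by simp
  have \<rho>: "?\<rho> \<in> carrier_mat ?N ?N"
    using Suc.prems by (intro noisy_circuit_carrier) auto
  let ?w = "\<lambda>x. \<Sum>i<?N. ?U $$ (x, i) * v i"
  have "unitary_channel ?U ?\<rho> $$ (x, y) = ?w x * cnj (?w y)" if "x < ?N" "y < ?N" for x y
  proof -
    have "unitary_channel ?U ?\<rho> $$ (x, y)
        = (\<Sum>j<?N. \<Sum>i<?N. ?U $$ (x, i) * v i * (cnj (?U $$ (y, j)) * cnj (v j)))"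
      unfolding unitary_channel_entry[OF U \<rho> that]
      by (intro sum.cong refl) (simp add: v mult_ac)
    also have "\<dots> = (\<Sum>i<?N. \<Sum>j<?N. ?U $$ (x, i) * v i * (cnj (?U $$ (y, j)) * cnj (v j)))"
      by (rule sum.swap)
    finally show ?thesis
      by (simp add: sum_product)
  qed
  moreover have "(\<Sum>x<?N. cnj (?w x) * ?w x) = 1"
  proof -
    \<comment> \<open>Expanded in full so that the sum over \<open>x\<close> can be moved innermost,
      where orthonormality of the columns applies.\<close>
    have "(\<Sum>x<?N. cnj (?w x) * ?w x)
        = (\<Sum>x<?N. \<Sum>y<?N. \<Sum>z<?N. cnj (v y) * v z * (cnj (?U $$ (x, y)) * ?U $$ (x, z)))"
      unfolding cnj_sum sum_product by (intro sum.cong refl) (simp add: mult_ac)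
    also have "\<dots> = (\<Sum>y<?N. \<Sum>x<?N. \<Sum>z<?N. cnj (v y) * v z * (cnj (?U $$ (x, y)) * ?U $$ (x, z)))"
      by (rule sum.swap)
    also have "\<dots> = (\<Sum>y<?N. \<Sum>z<?N. \<Sum>x<?N. cnj (v y) * v z * (cnj (?U $$ (x, y)) * ?U $$ (x, z)))"
      by (rule sum.cong[OF refl], rule sum.swap)
    also have "\<dots> = (\<Sum>y<?N. \<Sum>z<?N. cnj (v y) * v z * (if y = z then 1 else 0))"
      using Suc.prems(2)[of "Suc d"] by (simp add: sum_distrib_left[symmetric])
    also have "\<dots> = 1"
      using norm by (simp add: if_distrib cong: if_cong)
    finally show ?thesis .
  qed
  ultimately show ?case
    unfolding noiseless_circuit_Suc by (intro exI[of _ ?w] conjI allI impI) blast+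
qed

text \<open>Applying X to the qubits where \<open>x\<close> has a one exchanges the basis states
  \<open>x\<close> and 0. Outcome \<open>x\<close> thus becomes outcome 0 of a circuit with these
  flips in its last layer.\<close>

lemma output_prob_bit_flip:
  assumes U: "\<And>m. m \<in> {1..Suc d} \<Longrightarrow> U m \<in> carrier_mat (2 ^ n) (2 ^ n)" and x: "x < 2 ^ n"
  defines "s \<equiv> (\<lambda>i. if bit x i then PX else PI)"
  assumes V: "V (Suc d) = pauli_string n s * U (Suc d)" "\<And>m. m \<in> {1..d} \<Longrightarrow> V m = U m"
  shows "output_prob n (Suc d) V (\<lambda>_. id) 0 = output_prob n (Suc d) U (\<lambda>_. id) x"
proof -
  let ?N = "2 ^ n :: nat" and ?\<rho> = "noisy_circuit U (\<lambda>_. id) d (zero_state n)"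
  have \<rho>: "?\<rho> \<in> carrier_mat ?N ?N"
    using U by (intro noisy_circuit_carrier) auto
  have "noisy_circuit V (\<lambda>_. id) k \<sigma> = noisy_circuit U (\<lambda>_. id) k \<sigma>" if "k \<le> d" for k \<sigma>
    using that by (induction k) (auto simp: V(2))
  then have V\<rho>: "noisy_circuit V (\<lambda>_. id) (Suc d) (zero_state n)
      = unitary_channel (pauli_string n s) (unitary_channel (U (Suc d)) ?\<rho>)"
    using U \<rho> by (simp add: V(1) unitary_channel_mult[of _ ?N])
  \<comment> \<open>The product over qubits vanishes unless every bit of \<open>y\<close> agrees
    with that of \<open>x\<close>, so row 0 of the string picks out the entry \<open>(x, x)\<close>
    of the state.\<close>
  have *: "pauli_string n s $$ (0, y) = (if y = x then 1 else 0)" if "y < ?N" for y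
  proof -
    have "pauli_string n s $$ (0, y) = (\<Prod>i<n. if bit y i = bit x i then 1 else 0)"
      using that by (auto simp: pauli_string_def s_def intro!: prod.cong)
    then show ?thesis
      using nat_bits_eqI[OF that x] by auto
  qed
  have \<sigma>: "unitary_channel (U (Suc d)) ?\<rho> \<in> carrier_mat ?N ?N"
    using U \<rho> by simp
  have "unitary_channel (pauli_string n s) \<tau> $$ (0, 0) = \<tau> $$ (x, x)"
    if "\<tau> \<in> carrier_mat ?N ?N" for \<tau>
  proof -
    have "unitary_channel (pauli_string n s) \<tau> $$ (0, 0)
        = (\<Sum>j<?N. \<Sum>i<?N. pauli_string n s $$ (0, i) * \<tau> $$ (i, j) * cnj (pauli_string n s $$ (0, j)))"
      using that by (intro unitary_channel_entry) auto
    also have "\<dots> = (\<Sum>j<?N. \<Sum>i<?N. if i = x then (if j = x then \<tau> $$ (i, j) else 0) else 0)"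
      by (intro sum.cong refl) (simp add: *)
    also have "\<dots> = \<tau> $$ (x, x)"
      using x by simp
    finally show ?thesis .
  qed
  then show ?thesis
    unfolding output_prob_def V\<rho> using \<sigma> by simp
qed

subsection \<open>Probability\<close>

lemma borel_measurable_cnj:
  assumes "f \<in> borel_measurable M"
  shows "(\<lambda>x. cnj (f x)) \<in> borel_measurable M"
proof -
  have "cnj \<in> borel_measurable borel"
    by (intro borel_measurable_continuous_onI continuous_intros)
  then show ?thesis
    using assms measurable_compose by blast
qed

text \<open>Finite product measures are determined by boxes, and a componentwise map pulls boxes
  back to boxes; so invariance of the factors gives invariance of the product.\<close>

lemma distr_PiM_componentwise:
  assumes I: "finite I" and M: "\<And>i. prob_space (M i)"
    and f: "\<And>i. i \<in> I \<Longrightarrow> f i \<in> measurable (M i) (M i)"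
    and inv: "\<And>i. i \<in> I \<Longrightarrow> distr (M i) (M i) (f i) = M i"
  shows "(\<lambda>\<omega>. \<lambda>i\<in>I. f i (\<omega> i)) \<in> measurable (PiM I M) (PiM I M)"
    and "distr (PiM I M) (PiM I M) (\<lambda>\<omega>. \<lambda>i\<in>I. f i (\<omega> i)) = PiM I M"
proof -
  let ?F = "\<lambda>\<omega>. \<lambda>i\<in>I. f i (\<omega> i)"
  interpret product_sigma_finite M
    unfolding product_sigma_finite_def using M prob_space_imp_sigma_finite by blast
  show F: "?F \<in> measurable (PiM I M) (PiM I M)"
  proof (rule measurable_restrict)
    show "(\<lambda>\<omega>. f i (\<omega> i)) \<in> measurable (PiM I M) (M i)" if "i \<in> I" for i
      using measurable_component_singleton[OF that] f[OF that] by (rule measurable_compose)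
  qed
  show "distr (PiM I M) (PiM I M) ?F = PiM I M"
  proof (rule PiM_eqI[OF I])
    fix B assume B: "\<And>i. i \<in> I \<Longrightarrow> B i \<in> sets (M i)"
    have pre: "?F -` Pi\<^sub>E I B \<inter> space (PiM I M) = Pi\<^sub>E I (\<lambda>i. f i -` B i \<inter> space (M i))"
      by (auto simp: space_PiM PiE_iff extensional_def)
    have "emeasure (distr (PiM I M) (PiM I M) ?F) (Pi\<^sub>E I B)
        = emeasure (PiM I M) (Pi\<^sub>E I (\<lambda>i. f i -` B i \<inter> space (M i)))"
      using F B I by (simp add: emeasure_distr sets_PiM_I_finite pre)
    also have "\<dots> = (\<Prod>i\<in>I. emeasure (M i) (f i -` B i \<inter> space (M i)))"
      using f B I by (intro emeasure_PiM measurable_sets)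
    also have "\<dots> = (\<Prod>i\<in>I. emeasure (distr (M i) (M i) (f i)) (B i))"
      using f B by (intro prod.cong) (simp_all add: emeasure_distr)
    finally show "emeasure (distr (PiM I M) (PiM I M) ?F) (Pi\<^sub>E I B) = (\<Prod>i\<in>I. emeasure (M i) (B i))"
      using inv by simp
  qed simp
qed

text \<open>Jensen for the square: the weighted variance of \<open>q\<close> about its mean is
  nonnegative.\<close>

lemma sum_weighted_power2_le:
  fixes w q :: "'i \<Rightarrow> real"
  assumes w: "\<And>i. i \<in> S \<Longrightarrow> w i \<ge> 0" "(\<Sum>i\<in>S. w i) = 1"
  shows "(\<Sum>i\<in>S. w i * q i)\<^sup>2 \<le> (\<Sum>i\<in>S. w i * (q i)\<^sup>2)"
proof -
  define \<mu> where "\<mu> = (\<Sum>i\<in>S. w i * q i)"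
  have "0 \<le> (\<Sum>i\<in>S. w i * (q i - \<mu>)\<^sup>2)"
    using w by (intro sum_nonneg mult_nonneg_nonneg) auto
  also have "\<dots> = (\<Sum>i\<in>S. w i * (q i)\<^sup>2 - 2 * \<mu> * (w i * q i) + \<mu>\<^sup>2 * w i)"
    by (intro sum.cong refl) (simp add: power2_eq_square algebra_simps)
  also have "\<dots> = (\<Sum>i\<in>S. w i * (q i)\<^sup>2) - \<mu>\<^sup>2"
    by (simp add: sum.distrib sum_subtractf sum_distrib_left[symmetric] w \<mu>_def[symmetric] power2_eq_square)
  finally show ?thesis
    unfolding \<mu>_def by simp
qed

text \<open>Integrating a pointwise bound takes the place of Cauchy-Schwarz. Of the mean, half is
  lost below the threshold and a quarter is charged to the second moment, so \<open>B\<close> must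
  account for the last quarter; this is the 4 in the bound.\<close>

lemma (in prob_space) Paley_Zygmund:
  fixes X :: "'a \<Rightarrow> real"
  assumes X: "integrable M X" "integrable M (\<lambda>\<omega>. (X \<omega>)\<^sup>2)"
    and \<mu>: "expectation X = \<mu>" "\<mu> > 0"
    and C: "expectation (\<lambda>\<omega>. (X \<omega>)\<^sup>2) \<le> C * \<mu>\<^sup>2" "C > 0"
  shows "prob {\<omega> \<in> space M. X \<omega> \<ge> \<mu> / 2} \<ge> 1 / (4 * C)"
proof -
  define B where "B = {\<omega> \<in> space M. X \<omega> \<ge> \<mu> / 2}"
  define t where "t = 1 / (2 * C * \<mu>)"
  have t: "t > 0" using \<mu> C by (simp add: t_def)
  have B: "B \<in> events"
    unfolding B_def using borel_measurable_integrable[OF X(1)] by measurable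
  have int_B: "integrable M (indicat_real B)"
    using B by (intro integrable_real_indicator) (simp_all add: emeasure_eq_measure)
  \<comment> \<open>Off \<open>B\<close> the first summand suffices; on \<open>B\<close> the two
    others do.\<close>
  have *: "X \<omega> \<le> \<mu> / 2 + t / 2 * (X \<omega>)\<^sup>2 + 1 / (2 * t) * indicat_real B \<omega>" if "\<omega> \<in> space M" for \<omega>
  proof (cases "X \<omega> \<ge> \<mu> / 2")
    case True
    \<comment> \<open>AM-GM; the choice of \<open>t\<close> optimizes the resulting bound\<close>
    have "0 \<le> (t * X \<omega> - 1)\<^sup>2 / (2 * t)"
      using t by simp
    also have "\<dots> = t / 2 * (X \<omega>)\<^sup>2 + 1 / (2 * t) - X \<omega>"
      using t by (simp add: field_simps power2_eq_square)
    finally show ?thesis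
      using True that \<mu> by (simp add: B_def)
  next
    case False
    then have "X \<omega> \<le> \<mu> / 2" "indicat_real B \<omega> = 0" by (simp_all add: B_def)
    moreover have "0 \<le> t / 2 * (X \<omega>)\<^sup>2" using t by simp
    ultimately show ?thesis by simp
  qed
  have "expectation X \<le> (\<integral>\<omega>. \<mu> / 2 + t / 2 * (X \<omega>)\<^sup>2 + 1 / (2 * t) * indicat_real B \<omega> \<partial>M)"
    using X int_B * by (intro integral_mono) simp_all
  also have "\<dots> = \<mu> / 2 + t / 2 * expectation (\<lambda>\<omega>. (X \<omega>)\<^sup>2) + 1 / (2 * t) * prob B"
    using X int_B B by (simp add: prob_space)
  also have "\<dots> \<le> \<mu> / 2 + t / 2 * (C * \<mu>\<^sup>2) + 1 / (2 * t) * prob B"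
    using C t by simp
  also have "\<dots> = \<mu> / 2 + \<mu> / 4 + C * \<mu> * prob B"
    using \<mu> C by (simp add: t_def power2_eq_square field_simps)
  finally have "\<mu> / 4 \<le> C * \<mu> * prob B" by (simp add: \<mu>(1))
  then show ?thesis
    unfolding B_def using \<mu> C by (simp add: field_simps)
qed

subsection \<open>Pauli invariance of the Haar-random ensemble\<close>

locale random_circuit =
  fixes H :: "gate measure" and n d :: nat and A :: "nat \<Rightarrow> (nat \<times> nat) set"
  assumes haar: "haar_measure H"
    and pairing: "m \<in> {1..d} \<Longrightarrow> qubit_pairing n (A m)"
begin

abbreviation (input) "gates \<equiv> SIGMA m:{1..d}. A m"
abbreviation "M \<equiv> circuit_ensemble H d A"

lemma prob_space_H: "prob_space H"
  using haar by (simp add: haar_measure_def)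

lemma sets_H: "sets H = sets (restrict_space borel unitary_gates)"
  using haar by (simp add: haar_measure_def)

lemma space_H: "space H = unitary_gates"
  using sets_eq_imp_space_eq[OF sets_H] by (simp add: space_restrict_space)

lemma finite_gates: "finite gates"
  by (intro finite_SigmaI qubit_pairing_finite[OF pairing]) auto

sublocale M: prob_space M
  unfolding circuit_ensemble_def by (rule prob_space_PiM[OF prob_space_H])

lemma gate_unitary: "G \<in> space M \<Longrightarrow> m \<in> {1..d} \<Longrightarrow> e \<in> A m \<Longrightarrow> G (m, e) \<in> unitary_gates"
  unfolding circuit_ensemble_def space_PiM space_H by auto

text \<open>The unitary gates are closed under products and multiplication is continuous.
  Measurability is proved separately because \<open>haar_measure\<close> states only equations of
  \<open>distr\<close>, and computing \<open>emeasure\<close> of a \<open>distr\<close> requires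
  it.\<close>

lemma measurable_gate_mult_left:
  assumes V: "V \<in> unitary_gates"
  shows "(\<lambda>U. V ** U) \<in> measurable H H"
proof -
  have closed: "V ** U \<in> unitary_gates" if U: "U \<in> unitary_gates" for U
  proof -
    have adj: "gate_adjoint (V ** U) = gate_adjoint U ** gate_adjoint V"
      by (intro gate_eqI) (simp add: gate_adjoint_def matrix_matrix_mult_def mult.commute)
    have "V ** U ** (gate_adjoint U ** gate_adjoint V) = V ** (U ** gate_adjoint U) ** gate_adjoint V"
      and "gate_adjoint U ** gate_adjoint V ** (V ** U) = gate_adjoint U ** (gate_adjoint V ** V) ** U"
      by (simp_all add: matrix_mul_assoc)
    then show ?thesis
      using U V by (simp add: unitary_gates_def adj)
  qed
  have "continuous_on UNIV (\<lambda>U. V ** U)"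
    unfolding matrix_matrix_mult_def by (intro continuous_intros)
  then have "(\<lambda>U. V ** U) \<in> borel_measurable borel"
    by (rule borel_measurable_continuous_onI)
  then have "(\<lambda>U. V ** U) \<in> measurable (restrict_space borel unitary_gates) (restrict_space borel unitary_gates)"
    using closed by (intro measurable_restrict_space2 measurable_restrict_space1) (auto simp: space_restrict_space)
  then show ?thesis
    using measurable_cong_sets[OF sets_H sets_H] by blast
qed

text \<open>\<open>s m i\<close> names the Pauli matrix on qubit \<open>i\<close> after layer
  \<open>m\<close>, absorbed into the gate acting there. Restriction to \<open>gates\<close> makes
  the result a point of the product space, whose functions are extensional.\<close>

definition pauli_twist :: "(nat \<Rightarrow> nat \<Rightarrow> pauli) \<Rightarrow> (nat \<times> nat \<times> nat \<Rightarrow> gate) \<Rightarrow> nat \<times> nat \<times> nat \<Rightarrow> gate" where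
  "pauli_twist s G = (\<lambda>i\<in>gates. pauli_gate (s (fst i) (fst (snd i))) (s (fst i) (snd (snd i))) ** G i)"

text \<open>Each gate is multiplied from the left by a fixed unitary, which preserves its Haar
  measure; independence of the gates does the rest.\<close>

lemma pauli_twist_measurable: "pauli_twist s \<in> measurable M M"
  and distr_pauli_twist: "distr M M (pauli_twist s) = M"
proof -
  let ?f = "\<lambda>i U. pauli_gate (s (fst i) (fst (snd i))) (s (fst i) (snd (snd i))) ** U"
  have f: "?f i \<in> measurable H H" "distr H H (?f i) = H" for i
    using measurable_gate_mult_left[OF pauli_gate_unitary] haar pauli_gate_unitary
    unfolding haar_measure_def by blast+
  note * = distr_PiM_componentwise[of gates "\<lambda>_. H" ?f, OF finite_gates prob_space_H f]
  show "pauli_twist s \<in> measurable M M"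
    unfolding circuit_ensemble_def pauli_twist_def[abs_def] by (rule *(1))
  show "distr M M (pauli_twist s) = M"
    unfolding circuit_ensemble_def pauli_twist_def[abs_def] by (rule *(2))
qed

lemma expectation_pauli_twist:
  fixes f :: "_ \<Rightarrow> real"
  assumes "f \<in> borel_measurable M"
  shows "(\<integral>G. f (pauli_twist s G) \<partial>M) = (\<integral>G. f G \<partial>M)"
  using integral_distr[OF pauli_twist_measurable assms] by (simp add: distr_pauli_twist)

text \<open>Multiplying single gates realizes a Pauli string after the whole layer: the string is
  itself a layer over the same pairing, and layers multiply gate by gate.\<close>

lemma circuit_layers_pauli_twist:
  assumes m: "m \<in> {1..d}"
  shows "circuit_layers n A (pauli_twist s G) m = pauli_string n (s m) * circuit_layers n A G m"
proof -
  have "circuit_layers n A (pauli_twist s G) m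
      = layer_unitary n (A m) (\<lambda>e. pauli_gate (s m (fst e)) (s m (snd e)) ** G (m, e))"
    unfolding circuit_layers_def layer_unitary_def pauli_twist_def using m
    by (intro arg_cong[where f = "Matrix.mat _ _"] ext) (auto intro!: prod.cong)
  then show ?thesis
    by (simp add: circuit_layers_def pauli_string_eq_layer_unitary[OF pairing[OF m]]
        layer_unitary_mult[OF pairing[OF m]])
qed

lemma circuit_layers_carrier [simp]: "circuit_layers n A G m \<in> carrier_mat (2 ^ n) (2 ^ n)"
  by (simp add: circuit_layers_def)

section \<open>Noiseless output probabilities and their moments\<close>

definition ideal_prob :: "nat \<Rightarrow> (nat \<times> nat \<times> nat \<Rightarrow> gate) \<Rightarrow> real" where
  "ideal_prob x G = output_prob n d (circuit_layers n A G) (\<lambda>_. id) x"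

text \<open>By induction on the layers, the entries of the state are polynomials in the gate entries
  and their conjugates.\<close>

lemma ideal_prob_measurable:
  assumes "x < 2 ^ n"
  shows "ideal_prob x \<in> borel_measurable M"
proof -
  have entry: "(\<lambda>G. gate_entry (G i) a b) \<in> borel_measurable M" if "i \<in> gates" for i a b
  proof -
    have "continuous_on UNIV (\<lambda>U :: gate. gate_entry U a b)"
      by (intro continuous_intros)
    then have "(\<lambda>U. gate_entry U a b) \<in> borel_measurable H"
      using measurable_restrict_space1[OF borel_measurable_continuous_onI]
        measurable_cong_sets[OF sets_H refl] by blast
    then show ?thesis
      unfolding circuit_ensemble_def
      by (rule measurable_compose[where f = "\<lambda>G. G i", OF measurable_component_singleton[OF that]])
  qed
  have layer: "(\<lambda>G. circuit_layers n A G m $$ (x, y)) \<in> borel_measurable M"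
    if "m \<in> {1..d}" "x < 2 ^ n" "y < 2 ^ n" for m x y
    unfolding circuit_layers_def layer_unitary_entry[OF that(2,3)]
    using that(1) by (intro borel_measurable_prod entry) auto
  have "(\<lambda>G. noisy_circuit (circuit_layers n A G) (\<lambda>_. id) k (zero_state n) $$ (x, y)) \<in> borel_measurable M"
    if "k \<le> d" "x < 2 ^ n" "y < 2 ^ n" for k x y
    using that
  proof (induction k arbitrary: x y)
    case (Suc k)
    have "noisy_circuit (circuit_layers n A G) (\<lambda>_. id) k (zero_state n) \<in> carrier_mat (2 ^ n) (2 ^ n)" for G
      by (intro noisy_circuit_carrier) auto
    then have eq: "noisy_circuit (circuit_layers n A G) (\<lambda>_. id) (Suc k) (zero_state n) $$ (x, y)
      = (\<Sum>j<2 ^ n. \<Sum>i<2 ^ n. circuit_layers n A G (Suc k) $$ (x, i)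
          * noisy_circuit (circuit_layers n A G) (\<lambda>_. id) k (zero_state n) $$ (i, j)
          * cnj (circuit_layers n A G (Suc k) $$ (y, j)))" for G
      unfolding noiseless_circuit_Suc using Suc.prems by (intro unitary_channel_entry) auto
    show ?case
      unfolding eq using Suc.prems
      by (intro borel_measurable_sum borel_measurable_times borel_measurable_cnj layer Suc.IH) auto
  qed simp
  then show ?thesis
    unfolding ideal_prob_def[abs_def] output_prob_def using assms by simp
qed

text \<open>By \<open>noiseless_pure\<close> every probability is the squared modulus of an
  amplitude of a unit vector. The bounds 0 and 1 serve for integrability, the total for the
  mean.\<close>

lemma ideal_prob_distribution:
  assumes G: "G \<in> space M"
  shows "x < 2 ^ n \<Longrightarrow> 0 \<le> ideal_prob x G"
    and "(\<Sum>x<2 ^ n. ideal_prob x G) = 1"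
    and "x < 2 ^ n \<Longrightarrow> ideal_prob x G \<le> 1"
proof -
  have "\<exists>v :: nat \<Rightarrow> complex. (\<forall>x<2 ^ n. \<forall>y<2 ^ n.
      noisy_circuit (circuit_layers n A G) (\<lambda>_. id) d (zero_state n) $$ (x, y) = v x * cnj (v y)) \<and>
      (\<Sum>x<2 ^ n. cnj (v x) * v x) = 1"
  proof (rule noiseless_pure[OF circuit_layers_carrier])
    show "(\<Sum>x<2 ^ n. cnj (circuit_layers n A G m $$ (x, y)) * circuit_layers n A G m $$ (x, z))
        = (if y = z then 1 else 0)" if "m \<in> {1..d}" "y < 2 ^ n" "z < 2 ^ n" for m y z
      unfolding circuit_layers_def using that
      by (intro layer_unitary_isometry pairing gate_unitary[OF G])
  qed
  then obtain v :: "nat \<Rightarrow> complex" where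
    v: "\<forall>x<2 ^ n. \<forall>y<2 ^ n. noisy_circuit (circuit_layers n A G) (\<lambda>_. id) d (zero_state n) $$ (x, y)
      = v x * cnj (v y)" and norm: "(\<Sum>x<2 ^ n. cnj (v x) * v x) = 1"
    by blast
  have q: "ideal_prob x G = (cmod (v x))\<^sup>2" if "x < 2 ^ n" for x
    using v that unfolding ideal_prob_def output_prob_def
    by (simp add: complex_mult_cnj cmod_power2)
  show nonneg: "0 \<le> ideal_prob x G" if "x < 2 ^ n" for x
    using q[OF that] by simp
  have "complex_of_real (\<Sum>x<2 ^ n. ideal_prob x G) = (\<Sum>x<2 ^ n. cnj (v x) * v x)"
    unfolding of_real_sum by (intro sum.cong refl) (simp add: q complex_norm_square mult.commute del: of_real_power)
  then show sum: "(\<Sum>x<2 ^ n. ideal_prob x G) = 1"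
    unfolding norm by (metis of_real_eq_1_iff)
  show "ideal_prob x G \<le> 1" if "x < 2 ^ n" for x
    using member_le_sum[of x "{..<2 ^ n}" "\<lambda>x. ideal_prob x G"] nonneg that sum by simp
qed

lemma ideal_prob_integrable:
  assumes "x < 2 ^ n"
  shows "integrable M (ideal_prob x)" and "integrable M (\<lambda>G. (ideal_prob x G)\<^sup>2)"
proof -
  show "integrable M (ideal_prob x)"
    using ideal_prob_distribution assms
    by (intro M.integrable_const_bound[of _ 1] ideal_prob_measurable AE_I2) auto
  show "integrable M (\<lambda>G. (ideal_prob x G)\<^sup>2)"
    using ideal_prob_distribution assms
    by (intro M.integrable_const_bound[of _ 1] borel_measurable_power ideal_prob_measurable AE_I2)
      (auto simp: power_le_one)
qed

text \<open>The flip by the bits of \<open>x\<close> is absorbed into the last layer; the earlier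
  layers are twisted by identity strings.\<close>

lemma ideal_prob_flip:
  assumes d: "d \<ge> 1" and x: "x < 2 ^ n"
  shows "ideal_prob 0 (pauli_twist (\<lambda>m i. if m = d \<and> bit x i then PX else PI) G) = ideal_prob x G"
proof -
  let ?s = "\<lambda>m i. if m = d \<and> bit x i then PX else PI"
  \<comment> \<open>A nonzero depth provides a last layer to carry the flip.\<close>
  obtain k where k: "d = Suc k"
    using d by (cases d) auto
  have "pauli_string n (\<lambda>_. PI) = 1\<^sub>m (2 ^ n)"
  proof (rule eq_matI)
    fix y z assume "y < dim_row (1\<^sub>m (2 ^ n) :: complex mat)" "z < dim_col (1\<^sub>m (2 ^ n) :: complex mat)"
    then have "y < 2 ^ n" "z < 2 ^ n" by simp_all
    then show "pauli_string n (\<lambda>_. PI) $$ (y, z) = 1\<^sub>m (2 ^ n) $$ (y, z)"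
      using nat_bits_eqI[of y n z] by (auto simp: pauli_string_def)
  qed (simp_all add: pauli_string_def)
  then have "circuit_layers n A (pauli_twist ?s G) m = circuit_layers n A G m" if "m \<in> {1..k}" for m
    using circuit_layers_pauli_twist[of m ?s G] that k left_mult_one_mat[OF circuit_layers_carrier]
    by simp
  moreover have "circuit_layers n A (pauli_twist ?s G) (Suc k)
      = pauli_string n (\<lambda>i. if bit x i then PX else PI) * circuit_layers n A G (Suc k)"
    using circuit_layers_pauli_twist[of "Suc k" ?s G] k by simp
  ultimately have "output_prob n (Suc k) (circuit_layers n A (pauli_twist ?s G)) (\<lambda>_. id) 0
      = output_prob n (Suc k) (circuit_layers n A G) (\<lambda>_. id) x"
    by (intro output_prob_bit_flip x circuit_layers_carrier)
  then show ?thesis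
    unfolding ideal_prob_def using k by simp
qed

text \<open>By bit flips and invariance under twists, each of the \<open>2 ^ n\<close> outcomes has
  the moments of outcome 0. Summed over the outcomes, the probabilities give 1 and their squares the
  collision probability.\<close>

lemma ideal_prob_moments:
  assumes d: "d \<ge> 1"
  shows "(\<integral>G. ideal_prob 0 G \<partial>M) = 1 / 2 ^ n"
    and "(\<integral>G. (ideal_prob 0 G)\<^sup>2 \<partial>M)
      = (\<integral>G. collision_prob n d (circuit_layers n A G) (\<lambda>_. id) \<partial>M) / 2 ^ n"
proof -
  have moments: "(\<integral>G. ideal_prob x G \<partial>M) = (\<integral>G. ideal_prob 0 G \<partial>M)"
    "(\<integral>G. (ideal_prob x G)\<^sup>2 \<partial>M) = (\<integral>G. (ideal_prob 0 G)\<^sup>2 \<partial>M)" if "x < 2 ^ n" for x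
  proof -
    have meas: "ideal_prob 0 \<in> borel_measurable M"
      by (simp add: ideal_prob_measurable)
    show "(\<integral>G. ideal_prob x G \<partial>M) = (\<integral>G. ideal_prob 0 G \<partial>M)"
      using expectation_pauli_twist[OF meas] unfolding ideal_prob_flip[OF d that, symmetric] .
    show "(\<integral>G. (ideal_prob x G)\<^sup>2 \<partial>M) = (\<integral>G. (ideal_prob 0 G)\<^sup>2 \<partial>M)"
      using expectation_pauli_twist[OF borel_measurable_power[OF meas]]
      unfolding ideal_prob_flip[OF d that, symmetric] .
  qed
  have "2 ^ n * (\<integral>G. ideal_prob 0 G \<partial>M) = (\<Sum>x<2 ^ n::nat. \<integral>G. ideal_prob 0 G \<partial>M)"
    by simp
  also have "\<dots> = (\<Sum>x<2 ^ n. \<integral>G. ideal_prob x G \<partial>M)"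
    by (intro sum.cong refl moments(1)[symmetric]) simp
  also have "\<dots> = (\<integral>G. (\<Sum>x<2 ^ n. ideal_prob x G) \<partial>M)"
    by (rule Bochner_Integration.integral_sum[symmetric]) (simp add: ideal_prob_integrable)
  also have "\<dots> = (\<integral>G. 1 \<partial>M)"
    using ideal_prob_distribution(2) by (intro Bochner_Integration.integral_cong) auto
  finally show "(\<integral>G. ideal_prob 0 G \<partial>M) = 1 / 2 ^ n"
    by (simp add: M.prob_space field_simps)
  have "2 ^ n * (\<integral>G. (ideal_prob 0 G)\<^sup>2 \<partial>M) = (\<Sum>x<2 ^ n::nat. \<integral>G. (ideal_prob 0 G)\<^sup>2 \<partial>M)"
    by simp
  also have "\<dots> = (\<Sum>x<2 ^ n. \<integral>G. (ideal_prob x G)\<^sup>2 \<partial>M)"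
    by (intro sum.cong refl moments(2)[symmetric]) simp
  also have "\<dots> = (\<integral>G. (\<Sum>x<2 ^ n. (ideal_prob x G)\<^sup>2) \<partial>M)"
    by (rule Bochner_Integration.integral_sum[symmetric]) (simp add: ideal_prob_integrable)
  finally show "(\<integral>G. (ideal_prob 0 G)\<^sup>2 \<partial>M)
      = (\<integral>G. collision_prob n d (circuit_layers n A G) (\<lambda>_. id) \<partial>M) / 2 ^ n"
    by (simp add: collision_prob_def ideal_prob_def field_simps)
qed

text \<open>Every trajectory probability is \<open>ideal_prob 0\<close> composed with a
  measure-preserving twist, hence has the noiseless moments. Averaging with weights of sum 1 keeps
  the mean, and convexity of the square bounds the second moment.\<close>

lemma noisy_prob_moments:
  fixes p :: "nat \<Rightarrow> complex mat pmf"
  assumes p: "\<And>m. m \<in> {1..d} \<Longrightarrow> set_pmf (p m) \<subseteq> pauli_group n"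
  defines "X \<equiv> (\<lambda>G. output_prob n d (circuit_layers n A G) (\<lambda>m. pauli_channel n (p m)) 0)"
  shows "integrable M X" and "integrable M (\<lambda>G. (X G)\<^sup>2)"
    and "(\<integral>G. X G \<partial>M) = (\<integral>G. ideal_prob 0 G \<partial>M)"
    and "(\<integral>G. (X G)\<^sup>2 \<partial>M) \<le> (\<integral>G. (ideal_prob 0 G)\<^sup>2 \<partial>M)"
proof -
  let ?T = "{1..d} \<rightarrow>\<^sub>E pauli_group n"
  define w where "w E = (\<Prod>m\<in>{1..d}. pmf (p m) (E m))" for E
  have "\<forall>F\<in>pauli_group n. \<exists>a s. F = \<i> ^ a \<cdot>\<^sub>m pauli_string n s"
    by (auto simp: pauli_group_def paulis_on_def)
  \<comment> \<open>Any representation of an error as a phase times a string serves; one is fixed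
    for each error.\<close>
  then obtain a s where as: "\<And>F. F \<in> pauli_group n \<Longrightarrow> F = \<i> ^ a F \<cdot>\<^sub>m pauli_string n (s F)"
    by metis
  define q where "q E G = ideal_prob 0 (pauli_twist (\<lambda>m. s (E m)) G)" for E G
  have w: "w E \<ge> 0" for E
    by (simp add: w_def prod_nonneg)
  \<comment> \<open>The sum factors into the total masses of the \<open>p m\<close>, each 1 because
    its support lies in the finite Pauli group.\<close>
  have sum_w: "(\<Sum>E\<in>?T. w E) = 1"
    unfolding w_def
      sum_PiE_prod[of "{1..d}" "\<lambda>m. pmf (p m)" "\<lambda>_. pauli_group n", OF finite_atLeastAtMost]
    by (intro prod.neutral ballI sum_pmf_eq_1 finite_pauli_group p)
  \<comment> \<open>Phases cancel in each conjugation, so only the strings remain, and the twist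
    absorbs these.\<close>
  have trajectory: "noisy_circuit (\<lambda>m. E m * circuit_layers n A G m) (\<lambda>_. id) k (zero_state n)
      = noisy_circuit (circuit_layers n A (pauli_twist (\<lambda>m. s (E m)) G)) (\<lambda>_. id) k (zero_state n)"
    if E: "E \<in> ?T" and "k \<le> d" for E G k
    using \<open>k \<le> d\<close>
  proof (induction k)
    case (Suc k)
    let ?\<rho> = "noisy_circuit (circuit_layers n A (pauli_twist (\<lambda>m. s (E m)) G)) (\<lambda>_. id) k (zero_state n)"
    have F: "E (Suc k) \<in> pauli_group n"
      using E Suc.prems by (auto simp: PiE_iff)
    have \<rho>: "?\<rho> \<in> carrier_mat (2 ^ n) (2 ^ n)"
      by (intro noisy_circuit_carrier) auto
    let ?W = "pauli_string n (s (E (Suc k))) * circuit_layers n A G (Suc k)"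
    have W: "?W \<in> carrier_mat (2 ^ n) (2 ^ n)"
      by (rule mult_carrier_mat[OF pauli_string_carrier circuit_layers_carrier])
    have noisy: "E (Suc k) * circuit_layers n A G (Suc k) = \<i> ^ a (E (Suc k)) \<cdot>\<^sub>m ?W"
      by (subst as[OF F]) (rule mult_smult_assoc_mat[OF pauli_string_carrier circuit_layers_carrier])
    have twist: "circuit_layers n A (pauli_twist (\<lambda>m. s (E m)) G) (Suc k) = ?W"
      using Suc.prems by (intro circuit_layers_pauli_twist) simp
    have phase: "\<i> ^ b * cnj (\<i> ^ b) = 1" for b
      by (simp flip: power_mult_distrib)
    show ?case
      unfolding noiseless_circuit_Suc Suc.IH[OF Suc_leD[OF Suc.prems]] noisy twist
      by (rule unitary_channel_phase[OF W \<rho> phase])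
  qed simp
  have X: "X G = (\<Sum>E\<in>?T. w E * q E G)" for G
    unfolding X_def output_prob_def q_def ideal_prob_def
    by (subst noisy_circuit_pauli_trajectories)
      (simp_all add: trajectory w_def flip: of_real_prod)
  have int: "integrable M (q E)" "integrable M (\<lambda>G. (q E G)\<^sup>2)" for E
    unfolding q_def using ideal_prob_integrable[of 0]
    by (intro integrable_distr[OF pauli_twist_measurable]; simp add: distr_pauli_twist)+
  have E1: "(\<integral>G. q E G \<partial>M) = (\<integral>G. ideal_prob 0 G \<partial>M)" for E
    unfolding q_def by (rule expectation_pauli_twist) (simp add: ideal_prob_measurable)
  have E2: "(\<integral>G. (q E G)\<^sup>2 \<partial>M) = (\<integral>G. (ideal_prob 0 G)\<^sup>2 \<partial>M)" for E
    unfolding q_def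
    by (rule expectation_pauli_twist[of "\<lambda>G. (ideal_prob 0 G)\<^sup>2"])
      (intro borel_measurable_power ideal_prob_measurable zero_less_power zero_less_numeral)
  show X1: "integrable M X"
    unfolding X[abs_def] using int by simp
  have X2: "(X G)\<^sup>2 \<le> (\<Sum>E\<in>?T. w E * (q E G)\<^sup>2)" for G
    unfolding X by (rule sum_weighted_power2_le[OF w sum_w])
  have int2: "integrable M (\<lambda>G. \<Sum>E\<in>?T. w E * (q E G)\<^sup>2)"
    using int by simp
  \<comment> \<open>The square is dominated by the integrable mixture of squares from the convexity
    bound.\<close>
  show X3: "integrable M (\<lambda>G. (X G)\<^sup>2)"
    using X2 X1 by (intro Bochner_Integration.integrable_bound[OF int2])
      (auto intro!: AE_I2 order_trans[OF X2] borel_measurable_integrable borel_measurable_power)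
  show "(\<integral>G. X G \<partial>M) = (\<integral>G. ideal_prob 0 G \<partial>M)"
    using int unfolding X by (simp add: Bochner_Integration.integral_sum E1 sum_w del: One_nat_def flip: sum_distrib_right)
  have "(\<integral>G. (X G)\<^sup>2 \<partial>M) \<le> (\<integral>G. (\<Sum>E\<in>?T. w E * (q E G)\<^sup>2) \<partial>M)"
    using X2 by (intro integral_mono X3 int2)
  also have "\<dots> = (\<integral>G. (ideal_prob 0 G)\<^sup>2 \<partial>M)"
    using int by (simp add: Bochner_Integration.integral_sum E2 sum_w del: One_nat_def flip: sum_distrib_right)
  finally show "(\<integral>G. (X G)\<^sup>2 \<partial>M) \<le> (\<integral>G. (ideal_prob 0 G)\<^sup>2 \<partial>M)" .
qed

text \<open>The mean is \<open>1 / 2 ^ n\<close> and the second moment is at most \<open>C\<close>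
  times its square, as Paley-Zygmund demands. The resulting bound depends on \<open>C\<close> alone,
  which makes it uniform over the family.\<close>

lemma noisy_anticoncentration:
  fixes p :: "nat \<Rightarrow> complex mat pmf"
  assumes d: "d \<ge> 1" and p: "\<And>m. m \<in> {1..d} \<Longrightarrow> set_pmf (p m) \<subseteq> pauli_group n"
    and Z: "2 ^ n * (\<integral>G. collision_prob n d (circuit_layers n A G) (\<lambda>_. id) \<partial>M) \<le> C" and C: "C > 0"
  shows "M.prob {G \<in> space M. output_prob n d (circuit_layers n A G)
      (\<lambda>m. pauli_channel n (p m)) 0 \<ge> (1 / 2) / 2 ^ n} \<ge> 1 / (4 * C)"
proof -
  let ?X = "\<lambda>G. output_prob n d (circuit_layers n A G) (\<lambda>m. pauli_channel n (p m)) 0"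
  note X = noisy_prob_moments[OF p]
  have "(\<integral>G. (?X G)\<^sup>2 \<partial>M)
      \<le> (\<integral>G. collision_prob n d (circuit_layers n A G) (\<lambda>_. id) \<partial>M) / 2 ^ n"
    using X(4) by (simp add: ideal_prob_moments(2)[OF d])
  also have "\<dots> = (2 ^ n * (\<integral>G. collision_prob n d (circuit_layers n A G) (\<lambda>_. id) \<partial>M)) * (1 / 2 ^ n)\<^sup>2"
    by (simp add: power2_eq_square)
  also have "\<dots> \<le> C * (1 / 2 ^ n)\<^sup>2"
    using Z by (intro mult_right_mono) auto
  finally have "M.prob {G \<in> space M. ?X G \<ge> (1 / 2 ^ n) / 2} \<ge> 1 / (4 * C)"
    using C X(1-3) ideal_prob_moments(1)[OF d] by (intro M.Paley_Zygmund) auto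
  then show ?thesis
    by (simp add: mult.commute)
qed

end

theorem theorem4:
  fixes H :: "gate measure"
    and d :: "nat \<Rightarrow> nat"
    and A :: "nat \<Rightarrow> nat \<Rightarrow> (nat \<times> nat) set"
    and p :: "nat \<Rightarrow> nat \<Rightarrow> complex mat pmf"
    and k :: nat
    and c :: real
  assumes haar: "haar_measure H"
    and depth: "\<And>n. even n \<Longrightarrow> n > 0 \<Longrightarrow> d n \<ge> 1"
    and parallel: "\<And>n m. even n \<Longrightarrow> n > 0 \<Longrightarrow> m \<in> {1..d n} \<Longrightarrow> qubit_pairing n (A n m)"
    and pauli_noise: "\<And>n m. even n \<Longrightarrow> n > 0 \<Longrightarrow> m \<in> {1..d n} \<Longrightarrow> set_pmf (p n m) \<subseteq> pauli_group n"
    and local_noise: "\<And>n m. even n \<Longrightarrow> n > 0 \<Longrightarrow> m \<in> {1..d n} \<Longrightarrow> local_pauli_channel n k (p n m)"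
    and noiseless: "\<And>n. even n \<Longrightarrow> n > 0 \<Longrightarrow>
      2 ^ n * (\<integral>G. collision_prob n (d n) (circuit_layers n (A n) G) (\<lambda>_. id)
                 \<partial>circuit_ensemble H (d n) (A n)) \<le> c"
  shows "\<exists>\<alpha> c'. 0 < \<alpha> \<and> \<alpha> \<le> 1 \<and> c' > 0 \<and>
    (\<forall>n. even n \<longrightarrow> n > 0 \<longrightarrow>
       measure (circuit_ensemble H (d n) (A n))
         {G \<in> space (circuit_ensemble H (d n) (A n)).
            output_prob n (d n) (circuit_layers n (A n) G) (\<lambda>m. pauli_channel n (p n m)) 0
              \<ge> \<alpha> / 2 ^ n} \<ge> c')"
proof (intro exI conjI allI impI)
  fix n :: nat assume n: "even n" "n > 0"
  interpret random_circuit H n "d n" "A n"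
    by standard (use haar parallel[OF n] in auto)
  \<comment> \<open>This fixes the witnesses: \<open>\<alpha> = 1 / 2\<close> is the Paley-Zygmund
    threshold relative to the mean, and \<open>c' = 1 / (4 * max c 1)\<close>, where
    \<open>max\<close> gives a positive constant directly.\<close>
  show "measure (circuit_ensemble H (d n) (A n))
      {G \<in> space (circuit_ensemble H (d n) (A n)).
        output_prob n (d n) (circuit_layers n (A n) G) (\<lambda>m. pauli_channel n (p n m)) 0
          \<ge> (1 / 2) / 2 ^ n} \<ge> 1 / (4 * max c 1)"
    using noiseless[OF n] by (intro noisy_anticoncentration depth[OF n] pauli_noise[OF n]) auto
qed auto

end
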